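(* Let $\mathcal{X}$ be an uncountable Polish space and let $\mathcal{I},\mathcal{J}$ be $\sigma$-ideals on $\mathcal{X}$, each containing all countable subsets of $\mathcal{X}$ and having a Borel base. Assume that $\kappa=cov(\mathcal{I})=cof(\mathcal{I})\le non(\mathcal{J})$. Let $\mathcal{F}$ be a family of functions from $\mathcal{X}$ to $\mathcal{X}$ with $|\mathcal{F}|\le\kappa$. Then there is a sequence $(L_\alpha)_{\alpha<\kappa}$ of subsets of $\mathcal{X}$ such that (1) each $L_\alpha$ is a $(\kappa,\mathcal{I},\mathcal{J})$-Luzin set; (2) for $\alpha\neq\beta$, $L_\alpha$ is not equivalent to $L_\beta$ with respect to the family $\mathcal{F}$.
   Context: A $\sigma$-ideal on $\mathcal{X}$ is a proper family of subsets of $\mathcal{X}$ (i.e. $\mathcal{X}$ is not a member) closed under countable unions and under subsets. It has a Borel base if each of its members is contained in a Borel set belonging to the ideal. Cardinal coefficients: $non(\mathcal{J})=\min\{|A|: A\subseteq\mathcal{X},\ A\notin\mathcal{J}\}$; $cov(\mathcal{I})=\min\{|\mathcal{A}|:\mathcal{A}\subseteq\mathcal{I},\ \bigcup\mathcal{A}=\mathcal{X}\}$; $cof(\mathcal{I})=\min\{|\mathcal{A}|:\mathcal{A}\subseteq\mathcal{I},\ (\forall I\in\mathcal{I})(\exists A\in\mathcal{A})\ I\subseteq A\}$. A set $L\subseteq\mathcal{X}$ is an $(\mathcal{I},\mathcal{J})$-Luzin set if $L\notin\mathcal{I}$ and $B\cap L\in\mathcal{J}$ for every $B\in\mathcal{I}$.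 It is a $(\kappa,\mathcal{I},\mathcal{J})$-Luzin set if moreover $|L|=\kappa$. Sets $A,B\subseteq\mathcal{X}$ are equivalent with respect to $\mathcal{F}$ if there is $f\in\mathcal{F}$ with $B=f[A]$ or $A=f[B]$. *)

theory Defs
  imports "HOL-Analysis.Analysis"
begin

unbundle cardinal_syntax

text \<open>
  A Polish space is a type of class \<open>polish_space\<close>, so \<open>\<X>\<close> is \<open>UNIV\<close> and its Borel
  sets are \<open>sets borel\<close>. Cardinals are cardinal orders (\<open>Card_order\<close>), compared
  with \<open>\<le>o\<close> and \<open>=o\<close>.
\<close>

definition sigma_ideal :: "'a set set \<Rightarrow> bool" where
  "sigma_ideal I \<longleftrightarrow>
     UNIV \<notin> I \<and>
     (\<forall>\<A>. countable \<A> \<and> \<A> \<subseteq> I \<longrightarrow> \<Union>\<A> \<in> I) \<and>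
     (\<forall>A\<in>I. \<forall>B. B \<subseteq> A \<longrightarrow> B \<in> I)"

definition has_borel_base :: "'a::topological_space set set \<Rightarrow> bool" where
  "has_borel_base I \<longleftrightarrow> (\<forall>A\<in>I. \<exists>B\<in>sets borel. B \<in> I \<and> A \<subseteq> B)"

text \<open>
  \<open>min_card \<S>\<close> is \<open>min {|A| : A \<in> \<S>}\<close>; it is unspecified if \<open>\<S>\<close> is empty.
\<close>

definition min_card :: "'b set set \<Rightarrow> 'b rel" where
  "min_card \<S> = |SOME A. A \<in> \<S> \<and> (\<forall>B\<in>\<S>. |A| \<le>o |B| )|"

lemma min_card_minimum:
  assumes "\<S> \<noteq> {}"
  shows "\<exists>A\<in>\<S>. min_card \<S> = |A|" and "\<forall>B\<in>\<S>. min_card \<S> \<le>o |B|"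
proof -
  have "\<exists>r \<in> card_of ` \<S>. \<forall>r' \<in> card_of ` \<S>. r \<le>o r'"
    by (rule exists_minim_Card_order) (use assms card_of_Card_order in auto)
  then have "\<exists>A. A \<in> \<S> \<and> (\<forall>B\<in>\<S>. |A| \<le>o |B| )" by auto
  then show "\<exists>A\<in>\<S>. min_card \<S> = |A|" and "\<forall>B\<in>\<S>. min_card \<S> \<le>o |B|"
    unfolding min_card_def by (rule someI2_ex; blast)+
qed

definition non_ideal :: "'a set set \<Rightarrow> 'a rel" where
  "non_ideal J = min_card {A. A \<notin> J}"

definition cov_ideal :: "'a set set \<Rightarrow> 'a set rel" where
  "cov_ideal I = min_card {\<A>. \<A> \<subseteq> I \<and> \<Union>\<A> = UNIV}"

definition cof_ideal :: "'a set set \<Rightarrow> 'a set rel" where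
  "cof_ideal I = min_card {\<A>. \<A> \<subseteq> I \<and> (\<forall>B\<in>I. \<exists>A\<in>\<A>. B \<subseteq> A)}"

definition luzin_set :: "'a set set \<Rightarrow> 'a set set \<Rightarrow> 'a set \<Rightarrow> bool" where
  "luzin_set I J L \<longleftrightarrow> L \<notin> I \<and> (\<forall>B\<in>I. B \<inter> L \<in> J)"

definition card_luzin_set :: "'k rel \<Rightarrow> 'a set set \<Rightarrow> 'a set set \<Rightarrow> 'a set \<Rightarrow> bool" where
  "card_luzin_set \<kappa> I J L \<longleftrightarrow> luzin_set I J L \<and> |L| =o \<kappa>"

definition equivalent_wrt :: "('a \<Rightarrow> 'a) set \<Rightarrow> 'a set \<Rightarrow> 'a set \<Rightarrow> bool" where
  "equivalent_wrt F A B \<longleftrightarrow> (\<exists>f\<in>F. B = f ` A \<or> A = f ` B)"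

end

theory Submission
  imports Defs
begin

text \<open>
  List a cofinal family of \<open>I\<close> as \<open>B t\<close> for \<open>t\<close> in the field of \<open>\<kappa>\<close>, and build by transfinite
  recursion one injective sequence \<open>x\<close> with \<open>x s\<close> outside all \<open>B t\<close> with \<open>t\<close> below or equal to
  \<open>s\<close>. Choosing \<open>x s\<close> is possible because fewer than \<open>cov_ideal I\<close> members of \<open>I\<close> do not cover the
  space. Any \<open>\<kappa>\<close> terms of the sequence form a Luzin set: such a set is unbounded, so it is not
  contained in any \<open>B t\<close>, and it meets \<open>B t\<close> only in terms before \<open>t\<close>, that is, in fewer than
  \<open>non_ideal J\<close> points. Splitting the index set into \<open>\<kappa>\<close> parts of size \<open>\<kappa>\<close> thus gives pairwise
  disjoint Luzin sets \<open>L \<alpha>\<close>.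

  To separate their images, attach a function \<open>e s\<close> to each index so that every function of \<open>F\<close>
  is attached to some index of every part. The recursion keeps \<open>e s (x s)\<close> out of the sequence,
  apart from the harmless value \<open>x s\<close> itself: later terms are made to avoid it, and \<open>x s\<close> is chosen
  so that \<open>e s (x s)\<close> is not an earlier term, whenever some admissible point does this
  (lemma \<open>ex_avoiding_sequence\<close>). Let \<open>s\<close> be an index in the part \<open>\<alpha>\<close> with \<open>e s = f\<close>. If the
  choice succeeded, then \<open>f (x s)\<close> is a point of \<open>f ` L \<alpha>\<close> that lies in no other \<open>L \<beta>\<close>. If it
  failed, then \<open>f\<close> maps every admissible point, hence every term from \<open>x s\<close> on, to an
  earlier term; so \<open>f ` L \<alpha>\<close> has fewer than \<open>\<kappa>\<close> points and cannot be \<open>L \<beta>\<close>.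
\<close>

section \<open>Small families and small sets\<close>

lemma min_card_le:
  assumes "A \<in> \<S>"
  shows "min_card \<S> \<le>o |A|"
proof -
  from assms have "\<S> \<noteq> {}" by blast
  from min_card_minimum(2)[OF this] assms show ?thesis by (rule bspec)
qed

lemma min_card_attained:
  assumes "A \<in> \<S>"
  shows "\<exists>A. A \<in> \<S> \<and> min_card \<S> = |A|"
proof -
  from assms have "\<S> \<noteq> {}" by blast
  from min_card_minimum(1)[OF this] show ?thesis by (simp add: Bex_def)
qed

lemma not_covering_if_less_cov_ideal:
  assumes "\<A> \<subseteq> I" and "|\<A>| <o cov_ideal I"
  shows "\<Union>\<A> \<noteq> UNIV"
proof
  assume "\<Union>\<A> = UNIV"
  with assms(1) have "\<A> \<in> {\<A>. \<A> \<subseteq> I \<and> \<Union>\<A> = UNIV}" by simp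
  then have "cov_ideal I \<le>o |\<A>|"
    unfolding cov_ideal_def by (rule min_card_le)
  with not_ordLess_ordLeq[OF assms(2)] show False by simp
qed

lemma mem_if_less_non_ideal:
  assumes "|A| <o non_ideal J"
  shows "A \<in> J"
proof (rule ccontr)
  assume "A \<notin> J"
  then have "A \<in> {A. A \<notin> J}" by simp
  then have "non_ideal J \<le>o |A|"
    unfolding non_ideal_def by (rule min_card_le)
  with not_ordLess_ordLeq[OF assms] show False by simp
qed

lemma ex_minimal_cover:
  assumes "\<And>x. {x} \<in> I"
  shows "\<exists>\<A>\<subseteq>I. \<Union>\<A> = UNIV \<and> cov_ideal I = |\<A>|"
proof -
  have "range (\<lambda>x. {x}) \<in> {\<A>. \<A> \<subseteq> I \<and> \<Union>\<A> = UNIV}" using assms by auto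
  from min_card_attained[OF this] show ?thesis
    unfolding cov_ideal_def mem_Collect_eq conj_assoc .
qed

lemma ex_minimal_cofinal_family:
  "\<exists>\<A>\<subseteq>I. (\<forall>B\<in>I. \<exists>A\<in>\<A>. B \<subseteq> A) \<and> cof_ideal I = |\<A>|"
proof -
  have "I \<in> {\<A>. \<A> \<subseteq> I \<and> (\<forall>B\<in>I. \<exists>A\<in>\<A>. B \<subseteq> A)}" by auto
  from min_card_attained[OF this] show ?thesis
    unfolding cof_ideal_def mem_Collect_eq conj_assoc .
qed

text \<open>A finite subfamily of a \<open>\<sigma>\<close>-ideal has its union in the ideal, so it cannot cover the space.\<close>

lemma infinite_Field_if_cov_ideal:
  fixes \<kappa> :: "'k rel"
  assumes I: "sigma_ideal I" "\<And>x. {x} \<in> I"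
    and \<kappa>: "\<kappa> =o cov_ideal I" "Card_order \<kappa>"
  shows "infinite (Field \<kappa>)"
proof
  assume fin: "finite (Field \<kappa>)"
  obtain \<A> where \<A>: "\<A> \<subseteq> I" "\<Union>\<A> = UNIV" "cov_ideal I = |\<A>|"
    using ex_minimal_cover[OF I(2)] by blast
  have "|Field \<kappa>| =o |\<A>|"
    using ordIso_transitive[OF card_of_Field_ordIso[OF \<kappa>(2)] \<kappa>(1)] \<A>(3) by simp
  from card_of_ordIso_finite[OF this] fin have "countable \<A>" by (simp add: countable_finite)
  moreover have "\<Union>\<C> \<in> I" if "countable \<C>" "\<C> \<subseteq> I" for \<C>
    using I(1) that unfolding sigma_ideal_def by simp
  ultimately have "UNIV \<in> I" using \<A>(1,2) by metis
  with I(1) show False unfolding sigma_ideal_def by blast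
qed

lemma card_image_ordLess:
  assumes "|A| <o r"
  shows "|f ` A| <o r"
  by (rule ordLeq_ordLess_trans[OF card_of_image assms])

section \<open>The recursion\<close>

text \<open>
  Avoiding the sets \<open>B t\<close> makes the terms Luzin, avoiding the earlier terms makes the sequence
  injective, and avoiding the images of earlier terms under the functions attached to them keeps
  these images from entering the sequence later.
\<close>

definition forbidden :: "'k rel \<Rightarrow> ('k \<Rightarrow> 'a set) \<Rightarrow> ('k \<Rightarrow> 'a \<Rightarrow> 'a) \<Rightarrow> ('k \<Rightarrow> 'a) \<Rightarrow> 'k \<Rightarrow> 'a set" where
  "forbidden \<kappa> B e x s =
     \<Union> (B ` under \<kappa> s) \<union> x ` underS \<kappa> s \<union> (\<lambda>t. e t (x t)) ` underS \<kappa> s"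

text \<open>
  The forbidden set is a union of fewer than \<open>\<kappa>\<close> members of \<open>I\<close>: an initial segment of \<open>\<kappa>\<close> is
  smaller than \<open>\<kappa>\<close>, and the single points count as singletons in \<open>I\<close>.
\<close>

lemma forbidden_not_UNIV:
  fixes \<kappa> :: "'k rel"
  assumes \<kappa>: "Card_order \<kappa>" "infinite (Field \<kappa>)" "\<kappa> =o cov_ideal I"
    and B: "\<And>t. t \<in> Field \<kappa> \<Longrightarrow> B t \<in> I"
    and singletons: "\<And>y. {y} \<in> I"
    and s: "s \<in> Field \<kappa>"
  shows "forbidden \<kappa> B e x s \<noteq> UNIV"
proof -
  note Un_less = card_of_Un_ordLess_infinite_Field[OF \<kappa>(2,1)]
  define \<A> where "\<A> = B ` under \<kappa> s \<union> (\<lambda>t. {x t}) ` underS \<kappa> s \<union> (\<lambda>t. {e t (x t)}) ` underS \<kappa> s"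
  have below: "|underS \<kappa> s| <o \<kappa>" by (rule card_of_underS[OF \<kappa>(1) s])
  have "|{s}| <o \<kappa>"
    by (rule finite_ordLess_infinite)
      (simp_all add: Field_card_of card_of_well_order_on card_order_on_well_order_on \<kappa>)
  with below have "|underS \<kappa> s \<union> {s}| <o \<kappa>" by (rule Un_less)
  moreover have "under \<kappa> s \<subseteq> underS \<kappa> s \<union> {s}" by (auto simp: under_def underS_def)
  ultimately have "|under \<kappa> s| <o \<kappa>" by (rule ordLeq_ordLess_trans[OF card_of_mono1, rotated])
  with below have "|\<A>| <o \<kappa>" unfolding \<A>_def by (intro Un_less card_image_ordLess)
  from ordLess_ordIso_trans[OF this \<kappa>(3)] have "|\<A>| <o cov_ideal I" .
  moreover have "under \<kappa> s \<subseteq> Field \<kappa>" by (auto simp: under_def Field_def)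
  then have "\<A> \<subseteq> I" unfolding \<A>_def using B singletons by auto
  ultimately have "\<Union>\<A> \<noteq> UNIV" by (rule not_covering_if_less_cov_ideal[rotated])
  moreover have "\<Union>\<A> = forbidden \<kappa> B e x s" unfolding \<A>_def forbidden_def by auto
  ultimately show ?thesis by simp
qed

text \<open>
  At each step some point is admissible by \<open>forbidden_not_UNIV\<close>; among the admissible points
  \<open>y\<close> one with \<open>e s y\<close> outside the earlier terms is preferred. So if the chosen term is mapped to
  an earlier one, then all admissible points are.
\<close>

lemma ex_avoiding_sequence:
  fixes \<kappa> :: "'k rel" and e :: "'k \<Rightarrow> 'a \<Rightarrow> 'a"
  assumes \<kappa>: "Card_order \<kappa>" "infinite (Field \<kappa>)" "\<kappa> =o cov_ideal I"
    and B: "\<And>t. t \<in> Field \<kappa> \<Longrightarrow> B t \<in> I"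
    and singletons: "\<And>y. {y} \<in> I"
  shows "\<exists>x. \<forall>s\<in>Field \<kappa>. x s \<notin> forbidden \<kappa> B e x s \<and>
           (e s (x s) \<in> x ` underS \<kappa> s \<longrightarrow> (\<forall>y. y \<notin> forbidden \<kappa> B e x s \<longrightarrow> e s y \<in> x ` underS \<kappa> s))"
proof -
  define P where "P x s r \<longleftrightarrow> (s \<in> Field \<kappa> \<longrightarrow> r \<notin> forbidden \<kappa> B e x s \<and>
    (e s r \<in> x ` underS \<kappa> s \<longrightarrow> (\<forall>y. y \<notin> forbidden \<kappa> B e x s \<longrightarrow> e s y \<in> x ` underS \<kappa> s)))" for x s r
  have "\<exists>x. \<forall>s. P x s (x s)"
  proof (rule dependent_wf_choice)
    show "wf (\<kappa> - Id)"
      using \<kappa>(1) by (simp add: card_order_on_def well_order_on_def)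
  next
    fix x x' :: "'k \<Rightarrow> 'a" and s r
    assume "\<And>t. (t, s) \<in> \<kappa> - Id \<Longrightarrow> x t = x' t"
    then have same: "x t = x' t" if "t \<in> underS \<kappa> s" for t
      using that by (auto simp: underS_def)
    then have "x ` underS \<kappa> s = x' ` underS \<kappa> s"
      and "(\<lambda>t. e t (x t)) ` underS \<kappa> s = (\<lambda>t. e t (x' t)) ` underS \<kappa> s"
      by (auto intro!: image_cong)
    then show "P x s r = P x' s r" unfolding P_def forbidden_def by simp
  next
    fix x s
    show "\<exists>r. P x s r"
    proof (cases "s \<in> Field \<kappa>")
      case True
      have "forbidden \<kappa> B e x s \<noteq> UNIV"
        using \<kappa> B singletons True by (rule forbidden_not_UNIV)
      then obtain y where "y \<notin> forbidden \<kappa> B e x s" by blast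
      then show ?thesis unfolding P_def by blast
    qed (simp add: P_def)
  qed
  then show ?thesis unfolding P_def by blast
qed

section \<open>The index set\<close>

lemma ex_enumeration:
  fixes \<kappa> :: "'k rel"
  assumes "Card_order \<kappa>" and "|A| \<le>o \<kappa>"
  shows "\<exists>h. A \<subseteq> h ` Field \<kappa>"
proof -
  have "|A| \<le>o |Field \<kappa>|"
    by (rule ordLeq_ordIso_trans[OF assms(2) ordIso_symmetric[OF card_of_Field_ordIso[OF assms(1)]]])
  from iffD2[OF card_of_ordLeq this]
  obtain g where "inj_on g A" "g ` A \<subseteq> Field \<kappa>" by (elim exE conjE)
  then have "A \<subseteq> inv_into A g ` Field \<kappa>"
    by (force intro: image_eqI[of _ "inv_into A g"])
  then show ?thesis by blast
qed

text \<open>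
  A bijection of the field of \<open>\<kappa>\<close> with its square labels each index with a part and with a
  function.
\<close>

lemma ex_labelling:
  fixes \<kappa> :: "'k rel" and F :: "'b set"
  assumes \<kappa>: "Card_order \<kappa>" "infinite (Field \<kappa>)" and F: "|F| \<le>o \<kappa>"
  shows "\<exists>(a :: 'k \<Rightarrow> 'k) e. (\<forall>\<alpha>\<in>Field \<kappa>. |{s \<in> Field \<kappa>. a s = \<alpha>}| =o \<kappa>) \<and>
           (\<forall>\<alpha>\<in>Field \<kappa>. \<forall>f\<in>F. \<exists>s\<in>Field \<kappa>. a s = \<alpha> \<and> e s = f)"
proof -
  obtain h where h: "F \<subseteq> h ` Field \<kappa>" using ex_enumeration[OF \<kappa>(1) F] by blast
  have "|Field \<kappa>| =o |Field \<kappa> \<times> Field \<kappa>|"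
    by (rule ordIso_symmetric[OF card_of_Times_same_infinite[OF \<kappa>(2)]])
  from iffD2[OF card_of_ordIso this]
  obtain g where g: "bij_betw g (Field \<kappa>) (Field \<kappa> \<times> Field \<kappa>)" by (elim exE)
  have hit: "\<exists>s\<in>Field \<kappa>. g s = (\<alpha>, \<iota>)" if "\<alpha> \<in> Field \<kappa>" "\<iota> \<in> Field \<kappa>" for \<alpha> \<iota>
  proof -
    have "(\<alpha>, \<iota>) \<in> g ` Field \<kappa>" using that bij_betw_imp_surj_on[OF g] by simp
    then show ?thesis by (metis imageE)
  qed
  have "|{s \<in> Field \<kappa>. fst (g s) = \<alpha>}| =o \<kappa>" if \<alpha>: "\<alpha> \<in> Field \<kappa>" for \<alpha>
  proof -
    have "bij_betw (snd \<circ> g) {s \<in> Field \<kappa>. fst (g s) = \<alpha>} (Field \<kappa>)"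
    proof (rule bij_betw_imageI)
      show "inj_on (snd \<circ> g) {s \<in> Field \<kappa>. fst (g s) = \<alpha>}"
        using bij_betw_imp_inj_on[OF g] by (auto simp: inj_on_def prod_eq_iff)
      have "g s \<in> Field \<kappa> \<times> Field \<kappa>" if "s \<in> Field \<kappa>" for s
        using that bij_betw_apply[OF g] by blast
      then have "snd (g s) \<in> Field \<kappa>" if "s \<in> Field \<kappa>" for s
        using that by (metis mem_Times_iff)
      moreover have "\<iota> \<in> (snd \<circ> g) ` {s \<in> Field \<kappa>. fst (g s) = \<alpha>}" if "\<iota> \<in> Field \<kappa>" for \<iota>
        using hit[OF \<alpha> that] by force
      ultimately show "(snd \<circ> g) ` {s \<in> Field \<kappa>. fst (g s) = \<alpha>} = Field \<kappa>" by auto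
    qed
    then have "|{s \<in> Field \<kappa>. fst (g s) = \<alpha>}| =o |Field \<kappa>|" by (rule card_of_ordIsoI)
    from ordIso_transitive[OF this card_of_Field_ordIso[OF \<kappa>(1)]] show ?thesis .
  qed
  moreover have "\<exists>s\<in>Field \<kappa>. fst (g s) = \<alpha> \<and> h (snd (g s)) = f"
    if \<alpha>: "\<alpha> \<in> Field \<kappa>" and f: "f \<in> F" for \<alpha> f
  proof -
    from h f obtain \<iota> where \<iota>: "\<iota> \<in> Field \<kappa>" "h \<iota> = f" by blast
    obtain s where "s \<in> Field \<kappa>" "g s = (\<alpha>, \<iota>)" using hit[OF \<alpha> \<iota>(1)] by blast
    with \<iota>(2) show ?thesis by (intro bexI[of _ s]) simp_all
  qed
  ultimately show ?thesis
    by (intro exI[of _ "\<lambda>s. fst (g s)"] exI[of _ "\<lambda>s. h (snd (g s))"] conjI ballI)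
qed

section \<open>The Luzin sets\<close>

theorem theorem2p1:
  fixes I J :: "'a::polish_space set set"
    and F :: "('a \<Rightarrow> 'a) set"
    and \<kappa> :: "'k rel"
  assumes "uncountable (UNIV :: 'a set)"
    and "sigma_ideal I" and "\<And>A. countable A \<Longrightarrow> A \<in> I" and "has_borel_base I"
    and "sigma_ideal J" and "\<And>A. countable A \<Longrightarrow> A \<in> J" and "has_borel_base J"
    and "Card_order \<kappa>"
    and "\<kappa> =o cov_ideal I" and "cov_ideal I =o cof_ideal I" and "\<kappa> \<le>o non_ideal J"
    and "|F| \<le>o \<kappa>"
  shows "\<exists>L :: 'k \<Rightarrow> 'a set.
           (\<forall>\<alpha>\<in>Field \<kappa>. card_luzin_set \<kappa> I J (L \<alpha>)) \<and>
           (\<forall>\<alpha>\<in>Field \<kappa>. \<forall>\<beta>\<in>Field \<kappa>. \<alpha> \<noteq> \<beta> \<longrightarrow> \<not> equivalent_wrt F (L \<alpha>) (L \<beta>))"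
proof -
  note \<kappa> = \<open>Card_order \<kappa>\<close>
  have singletons: "{y} \<in> I" for y by (simp add: assms(3))
  have inf: "infinite (Field \<kappa>)"
    by (rule infinite_Field_if_cov_ideal[OF assms(2) singletons assms(9) \<kappa>])
  have order: "(s, t) \<in> \<kappa> \<or> (t, s) \<in> \<kappa>" if "s \<in> Field \<kappa>" "t \<in> Field \<kappa>" for s t
    using that \<kappa> wo_rel.TOTALS[of \<kappa>] by (auto simp: wo_rel_def card_order_on_well_order_on)
  then have trichotomy: "s \<in> underS \<kappa> t \<or> s = t \<or> t \<in> underS \<kappa> s"
    if "s \<in> Field \<kappa>" "t \<in> Field \<kappa>" for s t
    using that by (auto simp: underS_def)

  from ex_minimal_cofinal_family[of I]
  obtain \<A> where \<A>: "\<A> \<subseteq> I" "\<forall>B\<in>I. \<exists>A\<in>\<A>. B \<subseteq> A" "cof_ideal I = |\<A>|"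
    by (elim exE conjE)
  have "|\<A>| =o \<kappa>"
    using ordIso_symmetric[OF ordIso_transitive[OF assms(9,10)]] \<A>(3) by simp
  then have "|\<A>| \<le>o \<kappa>" by (rule ordIso_imp_ordLeq)
  from ex_enumeration[OF \<kappa> this]
  obtain B0 where B0: "\<A> \<subseteq> B0 ` Field \<kappa>" by (elim exE)
  \<comment> \<open>The enumeration may have values outside \<open>I\<close>; those are replaced by the empty set.\<close>
  define B where "B t = (if B0 t \<in> I then B0 t else {})" for t
  have B_ideal: "B t \<in> I" for t unfolding B_def using assms(3) by simp
  have cofinal: "\<exists>t\<in>Field \<kappa>. A \<subseteq> B t" if A: "A \<in> I" for A
  proof -
    obtain C where C: "C \<in> \<A>" "A \<subseteq> C" using \<A>(2) A by blast
    with B0 obtain t where "t \<in> Field \<kappa>" "C = B0 t" by blast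
    with C \<A>(1) have "A \<subseteq> B t" unfolding B_def by auto
    with \<open>t \<in> Field \<kappa>\<close> show ?thesis by blast
  qed

  from ex_labelling[OF \<kappa> inf assms(12)]
  obtain a :: "'k \<Rightarrow> 'k" and e where
      part_card: "\<forall>\<alpha>\<in>Field \<kappa>. |{s \<in> Field \<kappa>. a s = \<alpha>}| =o \<kappa>"
    and label: "\<forall>\<alpha>\<in>Field \<kappa>. \<forall>f\<in>F. \<exists>s\<in>Field \<kappa>. a s = \<alpha> \<and> e s = f"
    by (elim exE conjE)
  have "\<exists>x. \<forall>s\<in>Field \<kappa>. x s \<notin> forbidden \<kappa> B e x s \<and>
      (e s (x s) \<in> x ` underS \<kappa> s \<longrightarrow> (\<forall>y. y \<notin> forbidden \<kappa> B e x s \<longrightarrow> e s y \<in> x ` underS \<kappa> s))"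
    using \<kappa> inf assms(9) B_ideal singletons by (rule ex_avoiding_sequence)
  then obtain x where x: "\<forall>s\<in>Field \<kappa>. x s \<notin> forbidden \<kappa> B e x s \<and>
      (e s (x s) \<in> x ` underS \<kappa> s \<longrightarrow> (\<forall>y. y \<notin> forbidden \<kappa> B e x s \<longrightarrow> e s y \<in> x ` underS \<kappa> s))"
    by (elim exE)
  have admissible: "x s \<notin> forbidden \<kappa> B e x s" if "s \<in> Field \<kappa>" for s
    using bspec[OF x that] by (rule conjunct1)
  have preferred: "e s y \<in> x ` underS \<kappa> s"
    if "s \<in> Field \<kappa>" "e s (x s) \<in> x ` underS \<kappa> s" "y \<notin> forbidden \<kappa> B e x s" for s y
    using bspec[OF x that(1)] that(2,3) by simp
  have outside_B: "x s \<notin> B t" if "s \<in> Field \<kappa>" "(t, s) \<in> \<kappa>" for s t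
    using admissible[OF that(1)] that(2) unfolding forbidden_def under_def by blast
  have fresh: "x s \<noteq> x t" "x s \<noteq> e t (x t)" if "s \<in> Field \<kappa>" "t \<in> underS \<kappa> s" for s t
    using admissible[OF that(1)] that(2) unfolding forbidden_def by blast+
  have inj: "inj_on x (Field \<kappa>)"
    using trichotomy fresh(1) unfolding inj_on_def by metis
  have initial_small: "|underS \<kappa> s| <o \<kappa>" if "s \<in> Field \<kappa>" for s
    using card_of_underS[OF \<kappa> that] .

  define S where "S \<alpha> = {s \<in> Field \<kappa>. a s = \<alpha>}" for \<alpha>
  define L where "L \<alpha> = x ` S \<alpha>" for \<alpha>
  have L_card: "|L \<alpha>| =o \<kappa>" if "\<alpha> \<in> Field \<kappa>" for \<alpha>
  proof -
    have "inj_on x (S \<alpha>)" using inj unfolding S_def by (rule inj_on_subset) blast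
    then have "bij_betw x (S \<alpha>) (L \<alpha>)" unfolding L_def by (rule inj_on_imp_bij_betw)
    then have "|S \<alpha>| =o |L \<alpha>|" by (rule card_of_ordIsoI)
    then have "|L \<alpha>| =o |S \<alpha>|" by (rule ordIso_symmetric)
    moreover have "|S \<alpha>| =o \<kappa>" unfolding S_def by (rule bspec[OF part_card that])
    ultimately show ?thesis by (rule ordIso_transitive)
  qed
  have L_luzin: "luzin_set I J (L \<alpha>)" if \<alpha>: "\<alpha> \<in> Field \<kappa>" for \<alpha>
  proof -
    \<comment> \<open>A term in \<open>B t\<close> must have been chosen before \<open>B t\<close> became forbidden.\<close>
    have early: "A \<inter> L \<alpha> \<subseteq> x ` underS \<kappa> t" if t: "t \<in> Field \<kappa>" and "A \<subseteq> B t" for A t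
    proof
      fix y assume y: "y \<in> A \<inter> L \<alpha>"
      then obtain s where s: "s \<in> Field \<kappa>" "y = x s" unfolding L_def S_def by blast
      have "x s \<in> B t" using y s \<open>A \<subseteq> B t\<close> by blast
      then have "(t, s) \<notin> \<kappa>" using outside_B[OF s(1)] by blast
      then have "s \<in> underS \<kappa> t" using order[OF s(1) t] by (auto simp: underS_def)
      with s show "y \<in> x ` underS \<kappa> t" by blast
    qed
    have small: "|A \<inter> L \<alpha>| <o \<kappa>" if "A \<in> I" for A
    proof -
      obtain t where t: "t \<in> Field \<kappa>" "A \<subseteq> B t" using cofinal[OF \<open>A \<in> I\<close>] by blast
      show ?thesis
        using card_of_mono1[OF early[OF t]] card_image_ordLess[OF initial_small[OF t(1)]]
        by (rule ordLeq_ordLess_trans)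
    qed
    have "L \<alpha> \<notin> I"
    proof
      assume "L \<alpha> \<in> I"
      from not_ordLess_ordIso[OF small[OF this]] L_card[OF \<alpha>] show False by simp
    qed
    moreover have "A \<inter> L \<alpha> \<in> J" if "A \<in> I" for A
      by (rule mem_if_less_non_ideal[OF ordLess_ordLeq_trans[OF small[OF that] assms(11)]])
    ultimately show ?thesis unfolding luzin_set_def by blast
  qed
  have not_image: "f ` L \<alpha> \<noteq> L \<beta>"
    if \<alpha>: "\<alpha> \<in> Field \<kappa>" and \<beta>: "\<beta> \<in> Field \<kappa>" and "\<alpha> \<noteq> \<beta>" and f: "f \<in> F" for \<alpha> \<beta> f
  proof
    assume eq: "f ` L \<alpha> = L \<beta>"
    obtain s where s: "s \<in> Field \<kappa>" "a s = \<alpha>" "e s = f" using label \<alpha> f by blast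
    show False
    proof (cases "e s (x s) \<in> x ` underS \<kappa> s")
      case False
      have "x s \<in> L \<alpha>" unfolding L_def S_def using s by blast
      then have "f (x s) \<in> L \<beta>" using eq by blast
      then obtain t where t: "t \<in> Field \<kappa>" "a t = \<beta>" "e s (x s) = x t"
        unfolding L_def S_def using s(3) by auto
      have "t \<notin> underS \<kappa> s" using False t(3) by auto
      moreover have "t \<noteq> s" using s(2) t(2) \<open>\<alpha> \<noteq> \<beta>\<close> by blast
      moreover have "s \<notin> underS \<kappa> t" using fresh(2)[OF t(1)] t(3) by metis
      ultimately show False using trichotomy[OF s(1) t(1)] by blast
    next
      case True
      let ?E = "x ` underS \<kappa> s"
      have "f y \<in> f ` ?E \<union> ?E" if y: "y \<in> L \<alpha>" for y
      proof -
        obtain t where t: "t \<in> Field \<kappa>" "y = x t" using y unfolding L_def S_def by blast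
        show ?thesis
        proof (cases "t \<in> underS \<kappa> s")
          case True
          with t show ?thesis by blast
        next
          case False
          \<comment> \<open>Forbidden sets grow along \<open>\<kappa>\<close>, so a term from \<open>x s\<close> on is still admissible at \<open>s\<close>.\<close>
          with order[OF s(1) t(1)] have st: "(s, t) \<in> \<kappa>" unfolding underS_def by auto
          have wo: "Well_order \<kappa>" using \<kappa> card_order_on_well_order_on by blast
          then have "trans \<kappa>" "antisym \<kappa>"
            unfolding well_order_on_def linear_order_on_def partial_order_on_def preorder_on_def
            by blast+
          with st have "under \<kappa> s \<subseteq> under \<kappa> t" "underS \<kappa> s \<subseteq> underS \<kappa> t"
            by (auto simp: under_incr underS_incr)
          then have "forbidden \<kappa> B e x s \<subseteq> forbidden \<kappa> B e x t" unfolding forbidden_def by blast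
          with admissible[OF t(1)] t(2) have "y \<notin> forbidden \<kappa> B e x s" by blast
          from preferred[OF s(1) True this] s(3) show ?thesis by simp
        qed
      qed
      then have "L \<beta> \<subseteq> f ` ?E \<union> ?E" unfolding eq[symmetric] by blast
      moreover have "|f ` ?E \<union> ?E| <o \<kappa>"
        by (intro card_of_Un_ordLess_infinite_Field[OF inf \<kappa>] card_image_ordLess
            initial_small[OF s(1)])
      ultimately have "|L \<beta>| <o \<kappa>" by (rule ordLeq_ordLess_trans[OF card_of_mono1])
      from not_ordLess_ordIso[OF this] L_card[OF \<beta>] show False by simp
    qed
  qed
  have "card_luzin_set \<kappa> I J (L \<alpha>)" if "\<alpha> \<in> Field \<kappa>" for \<alpha>
    unfolding card_luzin_set_def using L_luzin[OF that] L_card[OF that] by blast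
  moreover have "\<not> equivalent_wrt F (L \<alpha>) (L \<beta>)"
    if "\<alpha> \<in> Field \<kappa>" "\<beta> \<in> Field \<kappa>" "\<alpha> \<noteq> \<beta>" for \<alpha> \<beta>
    unfolding equivalent_wrt_def using not_image that by metis
  ultimately show ?thesis by blast
qed

end
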